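(* Let $\vec u\in\mathbb{R}^3\setminus\{\vec 0\}$ and let $\chi:\mathbb{R}^3\to[0,1]$ be a smooth cut-off function that vanishes on a ball centered at the origin and equals $1$ outside a compact set. Define $$\rho_{\vec u}:\mathbb{R}^3\to[0,\infty),\qquad \rho_{\vec u}(\vec x)=\chi(\vec x)\,\frac{1}{r^4}\left(|\vec u|+\frac{\vec x\cdot\vec u}{r}\right),\qquad r=|\vec x|.$$ Then $\rho_{\vec u}\ge0$, $\rho_{\vec u}=\mathcal{O}(r^{-4})$ as $r\to\infty$, and the Newtonian center of mass of $\rho_{\vec u}$ does not exist: $\int_{B_R(\vec 0)}\rho_{\vec u}\,\vec x\,dV$ does not converge in $\mathbb{R}^3$ as $R\to\infty$.
   Context: For a Newtonian matter density $\rho:\mathbb{R}^3\to[0,\infty)$ the mass is $m=\int_{\mathbb{R}^3}\rho\,dV$ and, if $m>0$, the center of mass is $\vec z=\frac1m\int_{\mathbb{R}^3}\rho\,\vec x\,dV$, where the latter integral is understood as the improper integral in spherical polar coordinates, $\lim_{R\to\infty}\int_{B_R(\vec 0)}\rho\,\vec x\,dV$, with $B_R(\vec 0)$ the open ball. $\rho=\mathcal{O}(r^{s})$ means $|\rho|\le Cr^s$ outside a compact set for some constant $C$. *)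

theory Defs
  imports "HOL-Analysis.Analysis" "HOL-Library.Landau_Symbols"
begin

text \<open>
  Class \<open>C\<^sup>k\<close> on the whole space: in finite dimension, \<open>f\<close> is \<open>C\<^sup>k\<^sup>+\<^sup>1\<close> iff it is everywhere
  (Frechet) differentiable and, for each fixed direction \<open>v\<close>, its derivative in direction
  \<open>v\<close> is \<open>C\<^sup>k\<close>.
\<close>

primrec C_k :: "nat \<Rightarrow> ('a::euclidean_space \<Rightarrow> 'b::euclidean_space) \<Rightarrow> bool" where
  "C_k 0 f \<longleftrightarrow> continuous_on UNIV f"
| "C_k (Suc k) f \<longleftrightarrow>
     (\<exists>f'. (\<forall>x. (f has_derivative f' x) (at x)) \<and> (\<forall>v. C_k k (\<lambda>x. f' x v)))"

definition smooth :: "('a::euclidean_space \<Rightarrow> 'b::euclidean_space) \<Rightarrow> bool" where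
  "smooth f \<longleftrightarrow> (\<forall>k. C_k k f)"

definition mass :: "(real^3 \<Rightarrow> real) \<Rightarrow> real" where
  "mass \<rho> = (LINT x|lborel. \<rho> x)"

definition ball_moment :: "(real^3 \<Rightarrow> real) \<Rightarrow> real \<Rightarrow> real^3" where
  "ball_moment \<rho> R = (LINT x:ball 0 R|lborel. \<rho> x *\<^sub>R x)"

text \<open>
  The integral of \<open>\<rho> x *\<^sub>R x\<close> over the whole space is understood as an improper integral, the
  limit of the integrals over balls. A density that is not integrable has Bochner integral 0
  and so is excluded by \<open>mass \<rho> > 0\<close>.
\<close>

definition has_center_of_mass :: "(real^3 \<Rightarrow> real) \<Rightarrow> real^3 \<Rightarrow> bool" where
  "has_center_of_mass \<rho> z \<longleftrightarrow>
     mass \<rho> > 0 \<and> (\<exists>I. (ball_moment \<rho> \<longlongrightarrow> I) at_top \<and> z = (1 / mass \<rho>) *\<^sub>R I)"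

text \<open>At \<open>x = 0\<close> division by zero yields 0; the cut-off \<open>chi\<close> vanishes there anyway.\<close>

definition rho :: "(real^3 \<Rightarrow> real) \<Rightarrow> real^3 \<Rightarrow> real^3 \<Rightarrow> real" where
  "rho chi u x = chi x * (1 / norm x ^ 4) * (norm u + (x \<bullet> u) / norm x)"

end

theory Submission
  imports Defs
begin

text \<open>
  For \<open>R\<close> so large that \<open>\<chi> = 1\<close> outside the ball of radius \<open>R\<close>, the moments over the balls of
  radii \<open>2 R\<close> and \<open>R\<close> differ by the moment of the shell between them. Its component along \<open>u\<close>
  is the integral of a function homogeneous of degree \<open>-3\<close>, hence does not depend on \<open>R\<close>. The term
  with \<open>\<bar>u\<bar>\<close> is odd and drops out, and the remaining integrand \<open>(x \<bullet> u)\<^sup>2 / r\<^sup>5\<close> is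
  positive almost everywhere; so the difference is a positive constant and the moments are not Cauchy.
\<close>

text \<open>Negative factors are allowed on purpose: \<open>c = R\<close> compares shells of
  different size, and \<open>c = -1\<close> gives the invariance of the integral under
  reflection.\<close>

lemma lborel_integral_scaleR:
  fixes f :: "'a::euclidean_space \<Rightarrow> 'b::{banach, second_countable_topology}"
  assumes [measurable]: "f \<in> borel_measurable borel" and c: "c \<noteq> 0"
  shows "(LINT x|lborel. f x) = \<bar>c\<bar> ^ DIM('a) *\<^sub>R (LINT x|lborel. f (c *\<^sub>R x))"
  by (subst lborel_affine[OF c, of 0]) (simp add: integral_density integral_distr)

text \<open>Half-open, so that it is exactly a difference of open balls and joins
  \<open>ball 0 R\<close> disjointly, with no boundary sphere to discard.\<close>

definition shell :: "real \<Rightarrow> 'a::real_normed_vector set" where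
  "shell R = {x. R \<le> norm x \<and> norm x < 2 * R}"

lemma shell_borel [measurable]: "shell R \<in> sets borel"
  unfolding shell_def by measurable

lemma shell_eq_ball_diff: "shell R = ball 0 (2 * R) - ball 0 R"
  by (auto simp: shell_def)

lemma scaleR_mem_shell: "R > 0 \<Longrightarrow> R *\<^sub>R x \<in> shell R \<longleftrightarrow> x \<in> shell 1"
  by (auto simp: shell_def)

lemma set_integrable_lborel_bounded:
  fixes f :: "'a::euclidean_space \<Rightarrow> 'b::{banach, second_countable_topology}"
  assumes [measurable]: "f \<in> borel_measurable borel" "A \<in> sets borel"
    and "bounded A" and bound: "\<And>x. x \<in> A \<Longrightarrow> norm (f x) \<le> B"
  shows "set_integrable lborel A f"
  unfolding set_integrable_def
proof (rule integrableI_bounded_set_indicator)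
  show "emeasure lborel A < \<infinity>"
    using \<open>bounded A\<close> by (rule emeasure_bounded_finite)
  show "AE x in lborel. x \<in> A \<longrightarrow> norm (f x) \<le> B"
    using bound by auto
qed auto

text \<open>The component along \<open>u\<close> of \<open>rho chi u x *\<^sub>R x\<close> wherever
  \<open>chi x = 1\<close>. Leaving the cut-off out makes the scaling law exact, so that every shell
  can be compared with \<open>shell 1\<close>.\<close>

definition shell_density :: "'a::real_inner \<Rightarrow> 'a \<Rightarrow> real" where
  "shell_density u x = 1 / norm x ^ 4 * (norm u + (x \<bullet> u) / norm x) * (x \<bullet> u)"

lemma borel_measurable_shell_density [measurable]:
  fixes u :: "'a::euclidean_space"
  shows "shell_density u \<in> borel_measurable borel"
  unfolding shell_density_def by measurable

lemma shell_density_scaleR: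
  assumes "R > 0"
  shows "R ^ 3 * shell_density u (R *\<^sub>R x) = shell_density u x"
proof -
  have "shell_density u (R *\<^sub>R x) = R / R ^ 4 * shell_density u x"
    using assms by (simp add: shell_density_def power_mult_distrib)
  also have "R / R ^ 4 = 1 / R ^ 3"
    using assms by (simp add: eval_nat_numeral)
  finally show ?thesis
    using assms by simp
qed

lemma shell_density_minus: "shell_density u (- x) = shell_density (- u) x"
  by (simp add: shell_density_def)

text \<open>The term with \<open>norm u\<close> changes sign under reflection and cancels, while the
  quadratic term doubles. At \<open>x = 0\<close> both sides are 0.\<close>

lemma shell_density_reflect:
  "shell_density u x + shell_density u (- x) = 2 * (x \<bullet> u)\<^sup>2 / norm x ^ 5"
proof -
  have "shell_density u x + shell_density u (- x) = 2 * (x \<bullet> u)\<^sup>2 / (norm x ^ 4 * norm x)"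
    by (simp add: shell_density_def algebra_simps power2_eq_square add_divide_distrib
        diff_divide_distrib)
  also have "norm x ^ 4 * norm x = norm x ^ 5"
    by (simp add: eval_nat_numeral)
  finally show ?thesis .
qed

text \<open>By Cauchy-Schwarz the quotient is at most \<open>norm u\<close> in absolute value; at
  \<open>x = 0\<close> it is 0 by the convention for division.\<close>

lemma norm_add_inner_divide_norm_bounds:
  fixes x u :: "'a::real_inner"
  shows "0 \<le> norm u + (x \<bullet> u) / norm x" "norm u + (x \<bullet> u) / norm x \<le> 2 * norm u"
  using Cauchy_Schwarz_ineq2[of x u] by (cases "x = 0"; simp add: field_simps abs_le_iff)+

lemma set_integrable_shell_density:
  fixes u :: "'a::euclidean_space"
  shows "set_integrable lborel (shell 1) (shell_density u)"
proof (rule set_integrable_lborel_bounded)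
  show "bounded (shell 1 :: 'a set)"
    unfolding shell_eq_ball_diff by (rule bounded_diff) simp
  show "norm (shell_density u x) \<le> 1 * (2 * norm u) * (2 * norm u)" if "x \<in> shell 1" for x
  proof -
    have "\<bar>1 / norm x ^ 4\<bar> \<le> 1"
      using that by (simp add: shell_def divide_le_eq_1 one_le_power)
    moreover have "\<bar>norm u + (x \<bullet> u) / norm x\<bar> \<le> 2 * norm u"
      using norm_add_inner_divide_norm_bounds[of u x] by simp
    moreover have "\<bar>x \<bullet> u\<bar> \<le> 2 * norm u"
      using Cauchy_Schwarz_ineq2[of x u] that mult_right_mono[of "norm x" 2 "norm u"]
      by (auto simp: shell_def)
    ultimately show ?thesis
      unfolding shell_density_def real_norm_def abs_mult by (intro mult_mono) auto
  qed
qed auto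

text \<open>The Jacobian \<open>R ^ 3\<close> of the dilation of three-dimensional space cancels the
  factor \<open>1 / R ^ 3\<close> from homogeneity. Equal contributions from all dyadic shells are a
  logarithmic divergence.\<close>

lemma integral_shell_density_eq:
  fixes u :: "real^3"
  assumes "R > 0"
  shows "(LINT x:shell R|lborel. shell_density u x) = (LINT x:shell 1|lborel. shell_density u x)"
proof -
  have "(LINT x:shell R|lborel. shell_density u x)
      = R ^ 3 * (LINT x|lborel. indicator (shell R) (R *\<^sub>R x) * shell_density u (R *\<^sub>R x))"
    using assms unfolding set_lebesgue_integral_def
    by (subst lborel_integral_scaleR[where c = R]) simp_all
  also have "\<dots> = (LINT x|lborel. R ^ 3 * (indicator (shell R) (R *\<^sub>R x) * shell_density u (R *\<^sub>R x)))"
    by simp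
  also have "\<dots> = (LINT x:shell 1|lborel. shell_density u x)"
    unfolding set_lebesgue_integral_def using assms
    by (intro Bochner_Integration.integral_cong)
       (auto simp: indicator_def scaleR_mem_shell shell_density_scaleR)
  finally show ?thesis .
qed

text \<open>The integrand can be negative where \<open>x \<bullet> u < 0\<close>, so positivity is
  not pointwise. Adding the reflected integrand gives a nonnegative function \<open>h\<close> with
  twice the integral.\<close>

lemma integral_shell_density_pos:
  fixes u :: "'a::euclidean_space"
  assumes "u \<noteq> 0"
  shows "(LINT x:shell 1|lborel. shell_density u x) > 0"
proof -
  define f where "f x = indicator (shell 1) x * shell_density u x" for x
  define h where "h x = f x + f (- x)" for x
  have f_int: "integrable lborel f"
    using set_integrable_shell_density[of u] unfolding set_integrable_def f_def by simp
  then have [measurable]: "f \<in> borel_measurable borel"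
    by (simp add: f_def)
  have refl: "(LINT x|lborel. f (- x)) = (LINT x|lborel. f x)"
    using lborel_integral_scaleR[of f "-1"] by simp
  \<comment> \<open>Reflecting \<open>x\<close> amounts to reflecting \<open>u\<close>, so
    integrability for \<open>- u\<close> applies.\<close>
  have f_int': "integrable lborel (\<lambda>x. f (- x))"
    using set_integrable_shell_density[of "- u"]
    unfolding set_integrable_def f_def
    by (simp add: shell_density_minus shell_def indicator_def)
  have h_eq: "h x = indicator (shell 1) x * (2 * (x \<bullet> u)\<^sup>2 / norm x ^ 5)" for x
    using shell_density_reflect[of u x] by (auto simp: h_def f_def indicator_def shell_def)
  have h_int: "integrable lborel h"
    unfolding h_def using f_int f_int' by simp
  have h_nonneg: "h x \<ge> 0" for x
    by (simp add: h_eq)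
  \<comment> \<open>On \<open>U\<close> the function \<open>h\<close> is positive, so a vanishing
    integral would make \<open>U\<close> a null set. The strict inequalities make \<open>U\<close>
    open, and the multiple of \<open>u\<close> of norm 3/2 shows that it is nonempty.\<close>
  define U where "U = {x :: 'a. 1 < norm x} \<inter> {x. norm x < 2} \<inter> {x. 0 < x \<bullet> u}"
  have "open U"
    unfolding U_def by (intro open_Int open_Collect_less continuous_intros)
  moreover have "((3 / 2) / norm u) *\<^sub>R u \<in> U"
    using assms by (simp add: U_def)
  ultimately have U_pos: "\<not> negligible U"
    using open_not_negligible by blast
  have "(LINT x|lborel. h x) \<noteq> 0"
  proof
    assume "(LINT x|lborel. h x) = 0"
    then have "AE x in lborel. h x = 0"
      using integral_nonneg_eq_0_iff_AE[OF h_int] h_nonneg by simp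
    then have "AE x in lborel. x \<notin> U"
      by (rule AE_mp) (auto simp: h_eq U_def shell_def)
    then have "U \<in> null_sets lborel"
      using \<open>open U\<close> by (subst AE_iff_null_sets) auto
    then show False
      using U_pos by (simp add: negligible_iff_null_sets null_sets_completionI)
  qed
  moreover have "(LINT x|lborel. h x) \<ge> 0"
    by (simp add: h_nonneg)
  moreover have "(LINT x|lborel. h x) = 2 * (LINT x|lborel. f x)"
    unfolding h_def using f_int f_int' refl by simp
  ultimately show ?thesis
    by (simp add: f_def set_lebesgue_integral_def)
qed

lemma rho_bounds:
  assumes "chi x \<in> {0..1}"
  shows rho_nonneg: "rho chi u x \<ge> 0" and rho_le: "rho chi u x \<le> 2 * norm u / norm x ^ 4"
proof -
  define s where "s = norm u + (x \<bullet> u) / norm x"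
  have s: "0 \<le> s" "s \<le> 2 * norm u"
    using norm_add_inner_divide_norm_bounds[of u x] by (simp_all add: s_def)
  show "rho chi u x \<ge> 0"
    using s assms by (simp add: rho_def flip: s_def)
  have "chi x * (1 / norm x ^ 4) * s \<le> 1 * (1 / norm x ^ 4) * (2 * norm u)"
    using s assms by (intro mult_mono) auto
  then show "rho chi u x \<le> 2 * norm u / norm x ^ 4"
    by (simp add: rho_def flip: s_def)
qed

lemma rho_bigo:
  assumes "\<And>x. chi x \<in> {0..1}"
  shows "rho chi u \<in> O[at_infinity](\<lambda>x. norm x powr (-4))"
proof (rule bigoI)
  have "norm (rho chi u x) \<le> 2 * norm u * norm (norm x powr (-4))" if "1 \<le> norm x" for x
  proof -
    have "norm x powr (-4) = 1 / norm x ^ 4"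
      using that by (simp add: powr_minus_divide)
    then show ?thesis
      using rho_bounds[of chi x u, OF assms] by simp
  qed
  then show "\<forall>\<^sub>F x in at_infinity. norm (rho chi u x) \<le> 2 * norm u * norm (norm x powr (-4))"
    unfolding eventually_at_infinity by blast
qed

lemma set_integrable_rho_moment:
  assumes "chi \<in> borel_measurable borel" and range: "\<And>x. chi x \<in> {0..1}"
    and "\<epsilon> > 0" and vanish: "\<And>x. x \<in> ball 0 \<epsilon> \<Longrightarrow> chi x = 0"
    and "A \<in> sets borel" "bounded A"
  shows "set_integrable lborel A (\<lambda>x. rho chi u x *\<^sub>R x)"
proof -
  note [measurable] = assms(1)
  obtain R where R: "\<And>x. x \<in> A \<Longrightarrow> norm x \<le> R"
    using \<open>bounded A\<close> by (auto simp: bounded_iff)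
  \<comment> \<open>The factor \<open>1 / norm x ^ 4\<close> blows up at the origin, but there
    \<open>chi\<close> vanishes; where \<open>chi\<close> can be nonzero, \<open>norm x\<close> is
    at least \<epsilon>.\<close>
  have rho_le_eps: "rho chi u x \<le> 2 * norm u / \<epsilon> ^ 4" for x
  proof (cases "norm x < \<epsilon>")
    case True
    then show ?thesis using vanish[of x] \<open>\<epsilon> > 0\<close> by (simp add: rho_def)
  next
    case False
    then have "2 * norm u / norm x ^ 4 \<le> 2 * norm u / \<epsilon> ^ 4"
      using \<open>\<epsilon> > 0\<close> by (intro frac_le power_mono) simp_all
    with rho_le[of chi x u, OF range] show ?thesis by (rule order_trans)
  qed
  show ?thesis
  proof (rule set_integrable_lborel_bounded)
    show "(\<lambda>x. rho chi u x *\<^sub>R x) \<in> borel_measurable borel"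
      unfolding rho_def by measurable
    show "norm (rho chi u x *\<^sub>R x) \<le> 2 * norm u / \<epsilon> ^ 4 * R" if "x \<in> A" for x
    proof -
      have "rho chi u x * norm x \<le> 2 * norm u / \<epsilon> ^ 4 * R"
        using \<open>\<epsilon> > 0\<close> by (intro mult_mono rho_le_eps R that) simp_all
      then show ?thesis
        using rho_nonneg[of chi x u, OF range] by simp
    qed
  qed fact+
qed

text \<open>The cut-off acts only inside the smaller ball, so the difference is a moment of the
  uncut density over the shell. Integrability on both pieces is what allows the integral over the
  larger ball to be split.\<close>

lemma ball_moment_rho_diff:
  assumes "chi \<in> borel_measurable borel" and range: "\<And>x. chi x \<in> {0..1}"
    and "\<epsilon> > 0" and vanish: "\<And>x. x \<in> ball 0 \<epsilon> \<Longrightarrow> chi x = 0"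
    and "R > 0" and one: "\<And>x. R \<le> norm x \<Longrightarrow> chi x = 1"
  shows "(ball_moment (rho chi u) (2 * R) - ball_moment (rho chi u) R) \<bullet> u
    = (LINT x:shell 1|lborel. shell_density u x)"
proof -
  note int = set_integrable_rho_moment[OF assms(1-4), where u = u]
  have shell_int: "set_integrable lborel (shell R) (\<lambda>x. rho chi u x *\<^sub>R x)"
    by (rule int) (simp_all add: shell_eq_ball_diff bounded_diff)
  have "ball_moment (rho chi u) (2 * R)
      = (LINT x:(ball 0 R \<union> shell R)|lborel. rho chi u x *\<^sub>R x)"
    using \<open>R > 0\<close> unfolding ball_moment_def
    by (intro arg_cong2[where f = "\<lambda>A. set_lebesgue_integral lborel A"]) (auto simp: shell_def)
  also have "\<dots> = ball_moment (rho chi u) R + (LINT x:shell R|lborel. rho chi u x *\<^sub>R x)"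
    unfolding ball_moment_def
    by (rule set_integral_Un[OF _ int shell_int]) (auto simp: shell_def)
  finally have "(ball_moment (rho chi u) (2 * R) - ball_moment (rho chi u) R) \<bullet> u
      = (LINT x:shell R|lborel. rho chi u x *\<^sub>R x) \<bullet> u"
    by simp
  also have "\<dots> = (LINT x|lborel. (indicator (shell R) x *\<^sub>R (rho chi u x *\<^sub>R x)) \<bullet> u)"
    using shell_int unfolding set_integrable_def set_lebesgue_integral_def
    by (subst integral_inner_left) auto
  also have "\<dots> = (LINT x:shell R|lborel. shell_density u x)"
    unfolding set_lebesgue_integral_def
    by (intro Bochner_Integration.integral_cong)
       (auto simp: indicator_def shell_def rho_def shell_density_def one)
  also have "\<dots> = (LINT x:shell 1|lborel. shell_density u x)"
    using \<open>R > 0\<close> by (rule integral_shell_density_eq)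
  finally show ?thesis .
qed

theorem mainTheorem5:
  fixes u :: "real^3" and chi :: "real^3 \<Rightarrow> real"
  assumes "u \<noteq> 0"
    and "smooth chi"
    and "\<forall>x. chi x \<in> {0..1}"
    and "\<exists>\<epsilon>>0. \<forall>x\<in>ball 0 \<epsilon>. chi x = 0"
    and "\<exists>K. compact K \<and> (\<forall>x. x \<notin> K \<longrightarrow> chi x = 1)"
  shows "(\<forall>x. rho chi u x \<ge> 0)
    \<and> rho chi u \<in> O[at_infinity](\<lambda>x. norm x powr (-4))
    \<and> \<not> (\<exists>z. has_center_of_mass (rho chi u) z)
    \<and> \<not> (\<exists>L. ((\<lambda>R. LINT x:ball 0 R|lborel. rho chi u x *\<^sub>R x) \<longlongrightarrow> L) at_top)"
proof -
  have "C_k 0 chi"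
    using assms(2) unfolding smooth_def by blast
  then have meas: "chi \<in> borel_measurable borel"
    by (intro borel_measurable_continuous_onI) simp
  have range: "chi x \<in> {0..1}" for x
    using assms(3) by blast
  obtain \<epsilon> where eps: "\<epsilon> > 0" "\<And>x. x \<in> ball 0 \<epsilon> \<Longrightarrow> chi x = 0"
    using assms(4) by blast
  obtain K where "compact K" and K: "\<And>x. x \<notin> K \<Longrightarrow> chi x = 1"
    using assms(5) by blast
  obtain B where B: "\<And>x. x \<in> K \<Longrightarrow> norm x \<le> B"
    using compact_imp_bounded[OF \<open>compact K\<close>] by (auto simp: bounded_iff)
  define c where "c = (LINT x:shell 1|lborel. shell_density u x)"
  \<comment> \<open>\<open>R > B\<close> puts \<open>K\<close> inside \<open>ball 0 R\<close>, and
    \<open>R > 0\<close> is required by the dilation argument.\<close>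
  have diff: "(ball_moment (rho chi u) (2 * R) - ball_moment (rho chi u) R) \<bullet> u = c"
    if "R > max 0 B" for R
  proof -
    have "chi x = 1" if "R \<le> norm x" for x
      using B[of x] K[of x] that \<open>R > max 0 B\<close> by fastforce
    then show ?thesis
      unfolding c_def using \<open>R > max 0 B\<close>
      by (intro ball_moment_rho_diff[OF meas range eps]) auto
  qed
  have div: "\<not> (ball_moment (rho chi u) \<longlongrightarrow> L) at_top" for L
  proof
    assume L: "(ball_moment (rho chi u) \<longlongrightarrow> L) at_top"
    \<comment> \<open>Along \<open>2 * R\<close> the moments would have the same limit
      \<open>L\<close>, so their difference would tend to 0 although it is eventually the constant
      \<open>c\<close>.\<close>
    have "filterlim (\<lambda>R::real. 2 * R) at_top at_top"
      by (intro filterlim_tendsto_pos_mult_at_top[OF tendsto_const]) (auto intro: filterlim_ident)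
    from filterlim_compose[OF L this]
    have "((\<lambda>R. (ball_moment (rho chi u) (2 * R) - ball_moment (rho chi u) R) \<bullet> u)
        \<longlongrightarrow> (L - L) \<bullet> u) at_top"
      using L by (intro tendsto_intros)
    moreover have "\<forall>\<^sub>F R in at_top.
        (ball_moment (rho chi u) (2 * R) - ball_moment (rho chi u) R) \<bullet> u = c"
      using eventually_gt_at_top[of "max 0 B"] by eventually_elim (rule diff)
    ultimately have "((\<lambda>R::real. c) \<longlongrightarrow> 0) at_top"
      by (simp add: tendsto_cong)
    then have "c = 0"
      by (simp add: tendsto_const_iff)
    then show False
      using integral_shell_density_pos[OF assms(1)] by (simp add: c_def)
  qed
  moreover have "ball_moment (rho chi u) = (\<lambda>R. LINT x:ball 0 R|lborel. rho chi u x *\<^sub>R x)"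
    by (simp add: fun_eq_iff ball_moment_def)
  \<comment> \<open>A center of mass would by definition make \<open>ball_moment\<close> converge,
    whatever the value of the mass.\<close>
  ultimately show ?thesis
    using rho_nonneg[of chi _ u, OF range] rho_bigo[of chi u, OF range]
    by (auto simp: has_center_of_mass_def)
qed

end
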